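(* Let $p\ge 2$ be an even integer and let $D_p(c)=(c-1)^4-4p(c+1)^2(c-p-1)$. The unique solution $c^*$ of $D_p(c)=0$ in the interval $[2p+1+\sqrt{8p},\infty)$ satisfies $$2p+3+\sqrt{8(p-1)}\;\le\; c^*\;\le\; 2p+3+\sqrt{8p}.$$ *)

theory Defs
  imports Complex_Main
begin

definition D :: "int \<Rightarrow> real \<Rightarrow> real" where
  "D p c = (c - 1) ^ 4 - 4 * of_int p * (c + 1) ^ 2 * (c - of_int p - 1)"

end

theory Submission imports Defs begin

text \<open>
  Put \<open>s = sqrt (8 * p)\<close>. Expanded in powers of \<open>v = c - (2 * p + 1 + s)\<close>, \<open>D p c\<close> has a
  negative constant term and nonnegative coefficients in degrees two to four, so \<open>D p c / v\<close>
  is strictly increasing for \<open>v > 0\<close>: once \<open>D p\<close> is nonnegative it stays positive.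
  Hence there is at most one zero, and it is located by the signs of \<open>D p\<close> at the two bounds,
  where \<open>D p\<close> becomes a polynomial in the respective square root whose coefficients all have
  the same sign.
\<close>

text \<open>Dividing the quartic by its variable turns the linear term into the constant
  \<open>B\<close>, so only the signs of the other coefficients matter.\<close>

lemma quartic_pos_after_nonneg:
  fixes A B C E a b :: real
  assumes "A > 0" "C \<ge> 0" "E \<ge> 0" "0 \<le> a" "a < b"
    and nonneg: "- A + B * a + C * a ^ 2 + E * a ^ 3 + a ^ 4 \<ge> 0"
  shows "- A + B * b + C * b ^ 2 + E * b ^ 3 + b ^ 4 > 0"
proof -
  let ?f = "\<lambda>x. - A + B * x + C * x ^ 2 + E * x ^ 3 + x ^ 4"
  have "a \<noteq> 0" using nonneg \<open>A > 0\<close> by auto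
  with assms have "a > 0" "b > 0" by auto
  have "a ^ 2 \<le> b ^ 2" "a ^ 3 \<le> b ^ 3"
    using assms by (auto intro!: power_mono)
  then have "C * (a * b * (b - a)) \<ge> 0" "E * (a * b * (b ^ 2 - a ^ 2)) \<ge> 0"
      "a * b * (b ^ 3 - a ^ 3) \<ge> 0" "A * (b - a) > 0" "b * ?f a \<ge> 0"
    using assms \<open>a > 0\<close> \<open>b > 0\<close> by simp_all
  \<comment> \<open>This compares \<open>?f b / b\<close> with \<open>?f a / a\<close> after
    multiplication by \<open>a * b\<close>. The terms in \<open>B\<close> cancel, and the term with
    \<open>A\<close> makes the inequality strict.\<close>
  moreover have "a * ?f b = b * ?f a + A * (b - a) + C * (a * b * (b - a))
      + E * (a * b * (b ^ 2 - a ^ 2)) + a * b * (b ^ 3 - a ^ 3)"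
    by algebra
  ultimately have "a * ?f b > 0" by linarith
  with \<open>a > 0\<close> show ?thesis by (simp add: zero_less_mult_iff)
qed

text \<open>Substituting \<open>s ^ 2 / 8\<close> for \<open>p\<close> makes every coefficient a
  polynomial in \<open>s\<close> alone, so its sign can be read off for
  \<open>s > 0\<close>.\<close>

lemma D_expansion:
  fixes s v :: real
  assumes "s ^ 2 = 8 * of_int p"
  shows "D p (2 * of_int p + 1 + s + v) =
    - (2 * s ^ 3 + 5 / 4 * s ^ 4 + s ^ 5 / 4) + (s ^ 5 / 8 + 3 / 4 * s ^ 4 - 2 * s ^ 2) * v
    + (s ^ 4 / 16 + 3 / 2 * s ^ 3 + 4 * s ^ 2) * v ^ 2 + (s ^ 2 / 2 + 4 * s) * v ^ 3 + v ^ 4"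
proof -
  have p: "of_int p = s ^ 2 / 8" using assms by simp
  show ?thesis unfolding D_def p
    by (simp add: field_simps power2_eq_square power3_eq_cube power4_eq_xxxx eval_nat_numeral)
qed

lemma D_pos_after_nonneg:
  fixes c d :: real
  assumes "p > 0" "2 * of_int p + 1 + sqrt (8 * of_int p) \<le> c" "c < d" "D p c \<ge> 0"
  shows "D p d > 0"
proof -
  define s where "s = sqrt (8 * of_int p)"
  define m where "m = 2 * of_int p + 1 + s"
  have s: "s > 0" "s ^ 2 = 8 * of_int p" using assms(1) by (auto simp: s_def)
  have eq: "D p x =
      - (2 * s ^ 3 + 5 / 4 * s ^ 4 + s ^ 5 / 4) + (s ^ 5 / 8 + 3 / 4 * s ^ 4 - 2 * s ^ 2) * (x - m)
      + (s ^ 4 / 16 + 3 / 2 * s ^ 3 + 4 * s ^ 2) * (x - m) ^ 2 + (s ^ 2 / 2 + 4 * s) * (x - m) ^ 3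
      + (x - m) ^ 4" for x
    using D_expansion[OF s(2), of "x - m"] by (simp add: m_def)
  have pos: "0 < 2 * s ^ 3 + 5 / 4 * s ^ 4 + s ^ 5 / 4"
      "0 \<le> s ^ 4 / 16 + 3 / 2 * s ^ 3 + 4 * s ^ 2" "0 \<le> s ^ 2 / 2 + 4 * s"
    using s(1) by (auto intro!: add_pos_pos add_nonneg_nonneg)
  have "0 \<le> c - m" "c - m < d - m" using assms by (auto simp: m_def s_def)
  then show ?thesis
    using quartic_pos_after_nonneg[OF pos] \<open>D p c \<ge> 0\<close> unfolding eq by blast
qed

lemma D_upper_pos:
  assumes "p > 0"
  shows "D p (2 * of_int p + 3 + sqrt (8 * of_int p)) > 0"
proof -
  define s where "s = sqrt (8 * of_int p)"
  have s: "s > 0" "s ^ 2 = 8 * of_int p" using assms by (auto simp: s_def)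
  \<comment> \<open>The upper bound is the shift \<open>v = 2\<close> from the left endpoint, at
    which the terms in \<open>s ^ 5\<close> cancel.\<close>
  have "D p (2 * of_int p + 3 + s) = 16 + 32 * s + 16 * s ^ 2 + 4 * s ^ 3 + s ^ 4 / 2"
    using D_expansion[OF s(2), of 2]
    by (simp add: add.commute add.left_commute field_simps)
  also have "\<dots> > 0" using s(1) by (auto intro!: add_pos_pos)
  finally show ?thesis by (simp add: s_def)
qed

text \<open>With \<open>p = 1 + w ^ 2 / 8\<close>, both parts of \<open>D\<close> have degree 8 in
  \<open>w\<close>, but everything above degree 2 cancels.\<close>

lemma D_lower_neg:
  assumes "p > 0"
  shows "D p (2 * of_int p + 3 + sqrt (8 * (of_int p - 1))) < 0"
proof -
  define w where "w = sqrt (8 * (of_int p - 1))"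
  have w: "w \<ge> 0" "w ^ 2 = 8 * (of_int p - 1)" using assms by (auto simp: w_def)
  have p: "of_int p = 1 + w ^ 2 / 8" unfolding w(2) by (simp add: field_simps)
  have "D p (2 * of_int p + 3 + w) = - (176 + 32 * w + 8 * w ^ 2)"
    unfolding D_def p
    by (simp add: field_simps power2_eq_square power3_eq_cube power4_eq_xxxx eval_nat_numeral)
  also have "\<dots> < 0" using w(1) zero_le_power2[of w] by linarith
  finally show ?thesis by (simp add: w_def)
qed

lemma lower_bound_ge:
  assumes "p \<ge> 2"
  shows "2 * of_int p + 1 + sqrt (8 * of_int p) \<le> 2 * of_int p + 3 + sqrt (8 * (of_int p - 1))"
proof -
  define w where "w = sqrt (8 * (of_int p - 1))"
  have w: "w ^ 2 = 8 * (of_int p - 1)" using assms by (simp add: w_def)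
  have "1 \<le> w" using assms by (simp add: w_def)
  \<comment> \<open>Since \<open>(2 + w) ^ 2 = 8 * p - 4 + 4 * w\<close>, the claim is exactly
    \<open>1 \<le> w\<close>.\<close>
  then have "8 * of_int p \<le> (2 + w) ^ 2"
    using w by (simp add: power2_sum)
  then have "sqrt (8 * of_int p) \<le> 2 + w"
    using \<open>1 \<le> w\<close> by (intro real_le_lsqrt) auto
  then show ?thesis by (simp add: w_def)
qed

theorem theorem5:
  fixes p :: int
  assumes "p \<ge> 2" and "even p"
  shows "(\<exists>!c::real. c \<in> {2 * of_int p + 1 + sqrt (8 * of_int p)..} \<and> D p c = 0) \<and>
    (\<forall>c::real. c \<in> {2 * of_int p + 1 + sqrt (8 * of_int p)..} \<and> D p c = 0 \<longrightarrow>
       2 * of_int p + 3 + sqrt (8 * (of_int p - 1)) \<le> c \<and>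
       c \<le> 2 * of_int p + 3 + sqrt (8 * of_int p))"
proof -
  define m :: real where "m = 2 * of_int p + 1 + sqrt (8 * of_int p)"
  define l :: real where "l = 2 * of_int p + 3 + sqrt (8 * (of_int p - 1))"
  define u :: real where "u = 2 * of_int p + 3 + sqrt (8 * of_int p)"
  have "p > 0" using assms by simp
  have order: "m \<le> l" "l \<le> u" "m \<le> u"
    using lower_bound_ge[OF assms(1)] by (auto simp: m_def l_def u_def)
  have sign: "D p l < 0" "D p u > 0"
    using D_lower_neg D_upper_pos \<open>p > 0\<close> by (auto simp: l_def u_def)
  have mono: "D p d > 0" if "m \<le> c" "c < d" "D p c \<ge> 0" for c d
    using D_pos_after_nonneg that \<open>p > 0\<close> unfolding m_def by blast
  have "continuous_on {l..u} (D p)"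
    unfolding D_def by (intro continuous_intros)
  then obtain r where r: "l \<le> r" "D p r = 0"
    using IVT'[of "D p" l 0 u] sign order by auto
  have unique: "c = d" if "m \<le> c" "D p c = 0" "m \<le> d" "D p d = 0" for c d
    using that mono[of c d] mono[of d c] by linarith
  \<comment> \<open>A zero below \<open>l\<close> would force \<open>D p l > 0\<close>; a zero above
    \<open>u\<close> would itself be a point of positivity, since \<open>D p u > 0\<close>.\<close>
  have bounds: "l \<le> c \<and> c \<le> u" if "m \<le> c" "D p c = 0" for c
    using that mono[of c l] mono[of u c] sign order by fastforce
  have "\<exists>!c. c \<in> {m..} \<and> D p c = 0"
    using r order unique by (intro ex1I[of _ r]) auto
  with bounds show ?thesis
    unfolding m_def l_def u_def by auto
qed

end
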